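(* Let $(\mathcal{A},\varphi)$ be a non-commutative probability space and $(a_i)_{i=1}^\infty$ a sequence in $\mathcal{A}$ with $\varphi(a_i)=0$, $\varphi(a_i^2)=1$ for all $i$ and uniformly bounded moments of all orders, i.e. $\sup_i|\varphi(a_i^n)|<\infty$ for each integer $n\ge 1$. Suppose that for each $N\ge 1$ the variables $a_1,\dots,a_N$ are BMT independent with respect to a digraph $G_N=(V_N,E_N)$ with $V_N=[N]$, where $G_{N-1}\subset G_N$. Then for every integer $m\ge 1$, as $N\to\infty$, $$\varphi\left[\left(\frac{a_1+\cdots+a_N}{\sqrt N}\right)^m\right]=\sum_{\pi\in P_2(m)} N^{-m/2}\sum_{\substack{\mathbf{i}:[m]\to[N]\\ \ker[\mathbf{i}]=\pi}} \mathbf{1}_{G_{\pi(\mathbf{i})}\subseteq G_{\mathbf{i}}}\;+\;O(N^{-1/2}),$$ where $G_{\mathbf{i}}$ is the restriction of $G_N$ to the vertices $i_1,\dots,i_m$ (the independence graph of $a_{i_1},\dots,a_{i_m}$), and $\mathbf{1}_{G_{\pi(\mathbf{i})}\subseteq G_{\mathbf{i}}}$ equals $1$ if $G_{\pi(\mathbf{i})}$ is a subgraph of $G_{\mathbf{i}}$ and $0$ otherwise.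
   Context: A non-commutative probability space is a pair $(\mathcal{A},\varphi)$ with $\mathcal{A}$ a complex unital algebra and $\varphi:\mathcal{A}\to\mathbb{C}$ linear with $\varphi(1)=1$. $[m]=\{1,\dots,m\}$. $P(m)$ is the set of partitions of $[m]$, and $P_2(m)$ is the set of pairings, i.e. partitions all of whose blocks have exactly two elements (empty if $m$ is odd). A digraph $G=(V,E)$ has a non-empty vertex set $V$ and an edge set $E\subset V\times V$ with no loops $(v,v)$. $G_1\subset G_2$ (subgraph) means inclusion of both vertex and edge sets. For $\mathbf{i}:[m]\to V$, write $i_k=\mathbf{i}(k)$. The kernel $\ker[\mathbf{i}]$ is the partition of $[m]$ given by $k\sim k'$ iff $i_k=i_{k'}$. The kernel subordinated to $G$, $\ker_G[\mathbf{i}]$, is the partition of $[m]$ given by: $k\sim k'$ iff $i_k=i_{k'}$ and $(i_\ell,i_k)\in E$ for every $\ell$ strictly between $k$ and $k'$ with $i_\ell\neq i_k$. BMT independence: a family of (not necessarily unital) subalgebras $(\mathcal{A}_i)_{i\in I}$ is BMT independent with respect to $(\varphi,G)$, $G=(I,E)$ a digraph, if for all $m\ge1$ and $a_1\in\mathcal{A}_{i_1},\dots,a_m\in\mathcal{A}_{i_m}$ one has $\varphi(a_1\cdots a_m)=\prod_{B\in\ker_G[\mathbf{i}]}\varphi((a_k)|_B)$, where $(a_k)|_B=a_{k_1}\cdots a_{k_r}$ for $B=\{k_1<\cdots<k_r\}$. Random variables $a_1,\dots,a_N$ are BMT independent with respect to $G_N$ ("have independence graph $G_N$") if the subalgebras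 they generate (polynomials in $a_i$ without constant term) are. Nesting-crossing graph: for blocks $B\ne C$ of $\pi\in P(m)$, $B$ is nested inside $C=\{c_1<\cdots<c_s\}$ if there is $k\in\{1,\dots,s-1\}$ with $c_k<b<c_{k+1}$ for all $b\in B$. $B$ and $C$ cross if there are $b,b'\in B$, $c,c'\in C$ with $b<c<b'<c'$ or $c<b<c'<b'$. $G_\pi$ is the digraph with vertex set $\pi$ and edges $(B,C)$, $B\neq C$, such that $B$ is nested inside $C$ or $B$ and $C$ cross; equivalently, there are $k,k'\in C$, $\ell\in B$ with $k<\ell<k'$. If $\ker[\mathbf{i}]=\pi$, $G_{\pi(\mathbf{i})}$ is obtained from $G_\pi$ by relabeling each vertex (block) $W$ as $i_k$ for $k\in W$. *)

theory Defs
  imports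
    Complex_Main
    "HOL-Library.Disjoint_Sets"
    "HOL-Library.FuncSet"
    "HOL-Library.Landau_Symbols"
    "Graph_Theory.Pair_Digraph"
    "Graph_Theory.Digraph_Component"
begin

section \<open>Non-commutative probability spaces\<close>

text \<open>
  The algebra is the whole carrier type. There is no library class of complex unital algebras,
  so scalar multiplication is an explicit parameter. The class \<^class>\<open>ring_1\<close> excludes the zero
  ring, but so does the existence of a linear \<open>\<phi>\<close> with \<open>\<phi> 1 = 1\<close>.
\<close>

locale nc_probability_space =
  Vector_Spaces.linear scale "(*)" \<phi>
  for scale :: "complex \<Rightarrow> 'a::ring_1 \<Rightarrow> 'a"
    and \<phi> :: "'a \<Rightarrow> complex" +
  assumes scale_mult_left: "scale c x * y = scale c (x * y)"
    and scale_mult_right: "x * scale c y = scale c (x * y)"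
    and state_one: "\<phi> 1 = 1"

definition nonunital_subalgebra :: "(complex \<Rightarrow> 'a::ring_1 \<Rightarrow> 'a) \<Rightarrow> 'a set \<Rightarrow> bool" where
  "nonunital_subalgebra scale S \<longleftrightarrow> module.subspace scale S \<and> (\<forall>x\<in>S. \<forall>y\<in>S. x * y \<in> S)"

text \<open>Subalgebras need not contain \<open>1\<close>, so this is the set of polynomials in \<open>x\<close> without
  constant term; see \<open>generated_subalgebra_eq\<close>.\<close>

definition generated_subalgebra :: "(complex \<Rightarrow> 'a::ring_1 \<Rightarrow> 'a) \<Rightarrow> 'a \<Rightarrow> 'a set" where
  "generated_subalgebra scale x = nonunital_subalgebra scale hull {x}"

section \<open>Kernels and partitions\<close>

text \<open>A tuple \<open>\<^bold>i : [m] \<rightarrow> V\<close> is a function on \<^typ>\<open>nat\<close> used only on \<open>{1..m}\<close>.\<close>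

definition index_kernel :: "nat \<Rightarrow> (nat \<Rightarrow> 'i) \<Rightarrow> nat set set" where
  "index_kernel m i =
     {1..m} // {(k, k'). k \<in> {1..m} \<and> k' \<in> {1..m} \<and> i k = i k'}"

definition subordinate_rel :: "'i pair_pre_digraph \<Rightarrow> nat \<Rightarrow> (nat \<Rightarrow> 'i) \<Rightarrow> nat rel" where
  "subordinate_rel G m i = {(k, k'). k \<in> {1..m} \<and> k' \<in> {1..m} \<and> i k = i k' \<and>
     (\<forall>l. min k k' < l \<and> l < max k k' \<and> i l \<noteq> i k \<longrightarrow> (i l, i k) \<in> parcs G)}"

definition subordinate_kernel :: "'i pair_pre_digraph \<Rightarrow> nat \<Rightarrow> (nat \<Rightarrow> 'i) \<Rightarrow> nat set set" where
  "subordinate_kernel G m i = {1..m} // subordinate_rel G m i"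

definition pairings :: "nat \<Rightarrow> nat set set set" where
  "pairings m = {\<pi>. partition_on {1..m} \<pi> \<and> (\<forall>B\<in>\<pi>. card B = 2)}"

section \<open>BMT independence\<close>

definition block_prod :: "(nat \<Rightarrow> 'a::monoid_mult) \<Rightarrow> nat set \<Rightarrow> 'a" where
  "block_prod a B = prod_list (map a (sorted_list_of_set B))"

definition BMT_independent ::
  "(complex \<Rightarrow> 'a::ring_1 \<Rightarrow> 'a) \<Rightarrow> ('a \<Rightarrow> complex) \<Rightarrow> 'i pair_pre_digraph \<Rightarrow> ('i \<Rightarrow> 'a set) \<Rightarrow> bool"
where
  "BMT_independent scale \<phi> G A \<longleftrightarrow>
     (\<forall>j\<in>pverts G. nonunital_subalgebra scale (A j)) \<and>
     (\<forall>m\<ge>1. \<forall>i a. (\<forall>k\<in>{1..m}. i k \<in> pverts G \<and> a k \<in> A (i k)) \<longrightarrow>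
        \<phi> (block_prod a {1..m}) = (\<Prod>B\<in>subordinate_kernel G m i. \<phi> (block_prod a B)))"

section \<open>Nesting-crossing graph\<close>

text \<open>\<open>sorted_list_of_set C ! k\<close> is the \<open>(k + 1)\<close>-st smallest element of \<open>C\<close>.\<close>

definition nested_inside :: "nat set \<Rightarrow> nat set \<Rightarrow> bool" where
  "nested_inside B C \<longleftrightarrow>
     (\<exists>k. Suc k < card C \<and>
        (\<forall>b\<in>B. sorted_list_of_set C ! k < b \<and> b < sorted_list_of_set C ! Suc k))"

definition crossing :: "nat set \<Rightarrow> nat set \<Rightarrow> bool" where
  "crossing B C \<longleftrightarrow>
     (\<exists>b\<in>B. \<exists>b'\<in>B. \<exists>c\<in>C. \<exists>c'\<in>C. b < c \<and> c < b' \<and> b' < c' \<or> c < b \<and> b < c' \<and> c' < b')"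

definition nc_graph :: "nat set set \<Rightarrow> nat set pair_pre_digraph" where
  "nc_graph \<pi> = \<lparr>pverts = \<pi>,
     parcs = {(B, C). B \<in> \<pi> \<and> C \<in> \<pi> \<and> B \<noteq> C \<and> (nested_inside B C \<or> crossing B C)}\<rparr>"

text \<open>Only meant for \<open>i\<close> constant on each block of \<open>\<pi>\<close>; then \<open>the_elem (i ` W)\<close> is the
  common value of \<open>i\<close> on \<open>W\<close>.\<close>

definition labelled_nc_graph :: "nat set set \<Rightarrow> (nat \<Rightarrow> 'i) \<Rightarrow> 'i pair_pre_digraph" where
  "labelled_nc_graph \<pi> i =
     (let lab = (\<lambda>W. the_elem (i ` W)) in
      \<lparr>pverts = lab ` pverts (nc_graph \<pi>),
       parcs = map_prod lab lab ` parcs (nc_graph \<pi>)\<rparr>)"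

section \<open>Consistency of the definitions\<close>

lemma (in nc_probability_space) generated_subalgebra_eq:
  "generated_subalgebra scale x = module.span scale {x ^ n | n. 1 \<le> n}"
proof -
  let ?P = "{x ^ n | n. 1 \<le> n}"
  have mul1: "x ^ n * y \<in> vs1.span ?P" if "1 \<le> n" "y \<in> vs1.span ?P" for n y
    using that(2)
  proof (induction rule: vs1.span_induct_alt)
    case base
    show ?case by (simp add: vs1.span_zero)
  next
    case (step c z y)
    then obtain p where p: "z = x ^ p" "1 \<le> p" by blast
    have "x ^ (n + p) \<in> ?P" using that p by (intro CollectI exI[of _ "n + p"]) simp
    hence "scale c (x ^ n * z) \<in> vs1.span ?P"
      using p by (auto simp: power_add[symmetric] intro: vs1.span_scale vs1.span_base)
    thus ?case using step by (simp add: distrib_left scale_mult_right vs1.span_add)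
  qed
  have mul: "y * z \<in> vs1.span ?P" if "y \<in> vs1.span ?P" and z: "z \<in> vs1.span ?P" for y z
    using that(1)
  proof (induction rule: vs1.span_induct_alt)
    case base
    show ?case by (simp add: vs1.span_zero)
  next
    case (step c w y)
    then obtain p where p: "w = x ^ p" "1 \<le> p" by blast
    have "scale c (w * z) \<in> vs1.span ?P" using mul1[OF p(2) z] p by (simp add: vs1.span_scale)
    thus ?case using step by (simp add: distrib_right scale_mult_left vs1.span_add)
  qed
  have sub: "nonunital_subalgebra scale (vs1.span ?P)"
    unfolding nonunital_subalgebra_def using mul by (simp add: vs1.subspace_span)
  have "x \<in> vs1.span ?P" by (rule vs1.span_base) (auto intro: exI[of _ 1])
  hence 1: "generated_subalgebra scale x \<subseteq> vs1.span ?P"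
    unfolding generated_subalgebra_def using sub by (intro hull_minimal) auto
  have "vs1.span ?P \<subseteq> S" if S: "nonunital_subalgebra scale S" "x \<in> S" for S
  proof (rule vs1.span_minimal)
    have "x ^ Suc n \<in> S" for n using S by (induction n) (auto simp: nonunital_subalgebra_def)
    thus "?P \<subseteq> S" by (auto simp: Suc_le_eq gr0_conv_Suc)
  qed (use S in \<open>simp add: nonunital_subalgebra_def\<close>)
  hence "vs1.span ?P \<subseteq> generated_subalgebra scale x"
    unfolding generated_subalgebra_def hull_def by blast
  with 1 show ?thesis by blast
qed

lemma equiv_subordinate_rel: "equiv {1..m} (subordinate_rel G m i)"
proof (intro equivI)
  show "subordinate_rel G m i \<subseteq> {1..m} \<times> {1..m}"
    by (auto simp: subordinate_rel_def)
  show "refl_on {1..m} (subordinate_rel G m i)"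
    by (auto simp: refl_on_def subordinate_rel_def)
  show "sym (subordinate_rel G m i)"
    by (auto simp: sym_def subordinate_rel_def min.commute max.commute)
  show "trans (subordinate_rel G m i)"
  proof (rule transI)
    fix x y z
    assume xy: "(x, y) \<in> subordinate_rel G m i" and yz: "(y, z) \<in> subordinate_rel G m i"
    have "(i l, i x) \<in> parcs G" if l: "min x z < l" "l < max x z" "i l \<noteq> i x" for l
    proof -
      have "l \<noteq> y" using l xy by (auto simp: subordinate_rel_def)
      hence "min x y < l \<and> l < max x y \<or> min y z < l \<and> l < max y z" using l by linarith
      thus ?thesis using l xy yz by (auto simp: subordinate_rel_def)
    qed
    thus "(x, z) \<in> subordinate_rel G m i" using xy yz by (auto simp: subordinate_rel_def)
  qed
qed

lemma nested_or_crossing_iff: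
  assumes "finite C" "B \<inter> C = {}" "B \<noteq> {}"
  shows "nested_inside B C \<or> crossing B C \<longleftrightarrow> (\<exists>k\<in>C. \<exists>k'\<in>C. \<exists>l\<in>B. k < l \<and> l < k')"
proof
  assume "nested_inside B C \<or> crossing B C"
  thus "\<exists>k\<in>C. \<exists>k'\<in>C. \<exists>l\<in>B. k < l \<and> l < k'"
  proof
    assume "nested_inside B C"
    then obtain k where k: "Suc k < card C"
      "\<forall>b\<in>B. sorted_list_of_set C ! k < b \<and> b < sorted_list_of_set C ! Suc k"
      by (auto simp: nested_inside_def)
    have "sorted_list_of_set C ! j \<in> C" if "j < card C" for j
      using that assms(1) by (metis length_sorted_list_of_set nth_mem set_sorted_list_of_set)
    with k assms(3) show ?thesis by (meson Suc_lessD ex_in_conv)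
  next
    assume "crossing B C"
    thus ?thesis unfolding crossing_def by blast
  qed
next
  assume "\<exists>k\<in>C. \<exists>k'\<in>C. \<exists>l\<in>B. k < l \<and> l < k'"
  then obtain c c' l where c: "c \<in> C" "c' \<in> C" "l \<in> B" "c < l" "l < c'" by blast
  let ?xs = "sorted_list_of_set C"
  have set: "set ?xs = C" and len: "length ?xs = card C" using assms(1) by auto
  define J where "J = {j. j < card C \<and> ?xs ! j < l}"
  have fin: "finite J" by (simp add: J_def)
  have "\<exists>j<card C. ?xs ! j = c" using c(1) set len by (metis in_set_conv_nth)
  hence ne: "J \<noteq> {}" using c(4) by (auto simp: J_def)
  define k where "k = Max J"
  have kJ: "k \<in> J" unfolding k_def using fin ne by (rule Max_in)
  obtain j' where j': "j' < card C" "?xs ! j' = c'"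
    using c(2) set len by (metis in_set_conv_nth)
  have "k < j'"
  proof (rule ccontr)
    assume "\<not> k < j'"
    hence "?xs ! j' \<le> ?xs ! k"
      using kJ len by (intro sorted_nth_mono) (auto simp: J_def)
    thus False using kJ j' c by (auto simp: J_def)
  qed
  hence Sk: "Suc k < card C" using j' by simp
  have "Suc k \<notin> J" using fin by (metis Max_ge k_def Suc_n_not_le_n)
  hence "l \<le> ?xs ! Suc k" using Sk by (auto simp: J_def)
  moreover have inC: "?xs ! Suc k \<in> C" "?xs ! k \<in> C"
    using Sk set len by (metis nth_mem, metis Suc_lessD nth_mem)
  ultimately have l: "?xs ! k < l" "l < ?xs ! Suc k"
    using kJ c(3) assms(2) by (auto simp: J_def order.order_iff_strict)
  show "nested_inside B C \<or> crossing B C"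
  proof (cases "\<forall>b\<in>B. ?xs ! k < b \<and> b < ?xs ! Suc k")
    case True
    thus ?thesis using Sk by (auto simp: nested_inside_def)
  next
    case False
    then obtain b where b: "b \<in> B" "b \<le> ?xs ! k \<or> ?xs ! Suc k \<le> b" by force
    hence "b < ?xs ! k \<or> ?xs ! Suc k < b" using inC assms(2)
      by (metis IntI empty_iff order_le_imp_less_or_eq)
    thus ?thesis unfolding crossing_def using b(1) c(3) l inC by blast
  qed
qed

end

theory Submission
  imports Defs
begin

text \<open>
  Expanding the power gives a sum over tuples \<open>\<^bold>i\<close> of mixed moments, each of which is a product of
  moments of single variables over the blocks of the subordinate kernel. This kernel refines the
  kernel of \<open>\<^bold>i\<close>, and its singletons contribute \<open>\<phi> (a j) = 0\<close>. So a non-zero term has all kernel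
  blocks of size at least two: either the kernel is a pairing, or \<open>\<^bold>i\<close> takes fewer than \<open>m / 2\<close>
  values. There are only \<open>O(N\<^bsup>(m - 1) / 2\<^esup>)\<close> tuples of the latter kind, with uniformly bounded terms.
  If the kernel is a pairing, the term is \<open>1\<close> when the subordinate kernel equals the kernel, and
  otherwise some pair is split into singletons and the term vanishes. Equality of the two kernels is
  exactly the subgraph condition.
\<close>

section \<open>Ordered products over blocks\<close>

lemma block_prod_const:
  assumes "finite B" "\<And>k. k \<in> B \<Longrightarrow> f k = x"
  shows "block_prod f B = x ^ card B"
proof -
  have "map f (sorted_list_of_set B) = map (\<lambda>_. x) (sorted_list_of_set B)"
    using assms by (intro map_cong) auto
  thus ?thesis by (simp add: block_prod_def map_replicate_const)
qed

lemma block_prod_Suc: "block_prod f {1..Suc m} = block_prod f {1..m} * f (Suc m)"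
proof -
  have "sorted_list_of_set {1..n} = [1..<Suc n]" for n :: nat
    by (simp add: atLeastLessThanSuc_atLeastAtMost [symmetric])
  thus ?thesis by (simp add: block_prod_def)
qed

lemma block_prod_cong: "(\<And>k. k \<in> B \<Longrightarrow> f k = g k) \<Longrightarrow> finite B \<Longrightarrow> block_prod f B = block_prod g B"
  unfolding block_prod_def by (intro arg_cong [where f = prod_list] map_cong) auto

text \<open>Multiplication need not commute, so each tuple contributes an ordered product. The
  induction splits off the last index, whose factor stands on the right, as in
  \<open>power_Suc2\<close>.\<close>

lemma sum_power_expand:
  fixes f :: "'i \<Rightarrow> 'a::semiring_1"
  assumes "finite A"
  shows "(\<Sum>j\<in>A. f j) ^ m = (\<Sum>i\<in>{1..m} \<rightarrow>\<^sub>E A. block_prod (f \<circ> i) {1..m})"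
proof (induction m)
  case 0
  show ?case by (simp add: block_prod_def)
next
  case (Suc m)
  have ins: "{1..Suc m} = insert (Suc m) {1..m}" by auto
  have "(\<Sum>i\<in>{1..Suc m} \<rightarrow>\<^sub>E A. block_prod (f \<circ> i) {1..Suc m})
      = (\<Sum>(y, g)\<in>A \<times> ({1..m} \<rightarrow>\<^sub>E A). block_prod (f \<circ> g(Suc m := y)) {1..Suc m})"
    unfolding ins PiE_insert_eq
    by (subst sum.reindex [OF inj_combinator]) (auto simp: case_prod_unfold)
  also have "\<dots> = (\<Sum>(y, g)\<in>A \<times> ({1..m} \<rightarrow>\<^sub>E A). block_prod (f \<circ> g) {1..m} * f y)"
    unfolding block_prod_Suc by (intro sum.cong) (auto intro!: arg_cong2 [where f = "(*)"] block_prod_cong)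
  also have "\<dots> = (\<Sum>g\<in>{1..m} \<rightarrow>\<^sub>E A. block_prod (f \<circ> g) {1..m}) * (\<Sum>j\<in>A. f j)"
    unfolding sum.cartesian_product [symmetric] by (subst sum.swap) (simp add: sum_product)
  finally show ?case by (simp only: Suc power_Suc2)
qed

section \<open>Kernels\<close>

lemma index_kernel_eq_fibres:
  "index_kernel m i = (\<lambda>v. {k \<in> {1..m}. i k = v}) ` i ` {1..m}"
proof -
  have "{(k, k'). k \<in> {1..m} \<and> k' \<in> {1..m} \<and> i k = i k'} `` {x} = {k \<in> {1..m}. i k = i x}"
    if "x \<in> {1..m}" for x
    using that by auto
  thus ?thesis unfolding index_kernel_def quotient_def by (auto simp: image_image)
qed

lemma partition_on_index_kernel: "partition_on {1..m} (index_kernel m i)"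
  unfolding index_kernel_def
proof (intro partition_on_quotient equivI)
  let ?r = "{(k, k'). k \<in> {1..m} \<and> k' \<in> {1..m} \<and> i k = i k'}"
  show "?r \<subseteq> {1..m} \<times> {1..m}" by blast
  show "refl_on {1..m} ?r" by (simp add: refl_on_def)
  show "sym ?r" by (simp add: sym_def)
  show "trans ?r" by (simp add: trans_def)
qed

lemma partition_on_subordinate_kernel: "partition_on {1..m} (subordinate_kernel G m i)"
  unfolding subordinate_kernel_def by (intro partition_on_quotient equiv_subordinate_rel)

lemma finite_subordinate_kernel: "finite (subordinate_kernel G m i)"
  using partition_on_subordinate_kernel by (rule finite_elements [rotated]) simp

lemma subordinate_kernelD:
  assumes "B \<in> subordinate_kernel G m i"
  shows "finite B" "B \<noteq> {}" "B \<subseteq> {1..m}" "k \<in> B \<Longrightarrow> the_elem (i ` B) = i k"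
    "1 \<le> card B" "card B \<le> m"
proof -
  show *: "B \<noteq> {}" "B \<subseteq> {1..m}"
    using partition_on_subordinate_kernel [of m G i] assms by (auto simp: partition_on_def)
  show fin: "finite B" using *(2) by (rule finite_subset) simp
  show "1 \<le> card B" using fin *(1) by (simp add: Suc_le_eq card_gt_0_iff)
  show "card B \<le> m" using card_mono [OF _ *(2)] by simp
  obtain x where "B = subordinate_rel G m i `` {x}"
    using assms by (auto simp: subordinate_kernel_def elim: quotientE)
  hence "\<forall>l\<in>B. i l = i x" by (auto simp: subordinate_rel_def)
  thus "the_elem (i ` B) = i k" if "k \<in> B"
    using that by (intro the_elem_image_unique) auto
qed

lemma card_subordinate_kernel_le: "card (subordinate_kernel G m i) \<le> m"
proof -
  have "subordinate_kernel G m i = (\<lambda>x. subordinate_rel G m i `` {x}) ` {1..m}"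
    by (auto simp: subordinate_kernel_def quotient_def)
  thus ?thesis using card_image_le [of "{1..m}"] by simp
qed

lemma sum_card_index_kernel: "(\<Sum>B\<in>index_kernel m i. card B) = m"
proof -
  have "\<Union> (index_kernel m i) = {1..m}" "disjoint (index_kernel m i)"
    using partition_on_index_kernel by (auto simp: partition_on_def)
  thus ?thesis using card_Union_disjoint [of "index_kernel m i"]
    by (metis atLeastAtMost_iff card_atLeastAtMost diff_Suc_1 finite_atLeastAtMost finite_subset Union_upper)
qed

lemma card_index_kernel: "card (index_kernel m i) = card (i ` {1..m})"
  unfolding index_kernel_eq_fibres
proof (intro card_image inj_onI)
  fix u v assume "u \<in> i ` {1..m}" and eq: "{k \<in> {1..m}. i k = u} = {k \<in> {1..m}. i k = v}"
  then obtain k where "k \<in> {k \<in> {1..m}. i k = u}" by blast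
  moreover from this have "k \<in> {k \<in> {1..m}. i k = v}" unfolding eq .
  ultimately show "u = v" by simp
qed

text \<open>The BMT factorisation of a mixed moment, with \<open>c j n\<close> in the role of the
  \<open>n\<close>-th moment of variable \<open>j\<close>. Abstracting from the state keeps the
  following arguments purely combinatorial.\<close>

definition kernel_moment ::
  "('i \<Rightarrow> nat \<Rightarrow> 'c::comm_monoid_mult) \<Rightarrow> 'i pair_pre_digraph \<Rightarrow> nat \<Rightarrow> (nat \<Rightarrow> 'i) \<Rightarrow> 'c" where
  "kernel_moment c G m i = (\<Prod>B\<in>subordinate_kernel G m i. c (the_elem (i ` B)) (card B))"

text \<open>An index related only to itself forms a singleton block, whose factor is the vanishing
  first moment.\<close>

lemma kernel_moment_eq_0:
  fixes c :: "'i \<Rightarrow> nat \<Rightarrow> 'c::{comm_semiring_1}"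
  assumes "k \<in> {1..m}" "c (i k) 1 = 0"
    and only: "\<And>k'. (k, k') \<in> subordinate_rel G m i \<Longrightarrow> k' = k"
  shows "kernel_moment c G m i = 0"
proof -
  have "subordinate_rel G m i `` {k} = {k}"
    using only equiv_class_self [OF equiv_subordinate_rel assms(1), of G i] by auto
  hence "{k} \<in> subordinate_kernel G m i"
    unfolding subordinate_kernel_def using assms(1) by (metis quotientI)
  thus ?thesis unfolding kernel_moment_def
    using assms(2) by (subst prod.remove [OF finite_subordinate_kernel]) auto
qed

lemma norm_kernel_moment_le:
  fixes c :: "'i \<Rightarrow> nat \<Rightarrow> 'c::real_normed_field"
  assumes "1 \<le> K" "\<And>k n. k \<in> {1..m} \<Longrightarrow> 1 \<le> n \<Longrightarrow> n \<le> m \<Longrightarrow> norm (c (i k) n) \<le> K"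
  shows "norm (kernel_moment c G m i) \<le> K ^ m"
proof -
  have "norm (kernel_moment c G m i) \<le> (\<Prod>B\<in>subordinate_kernel G m i. K)"
    unfolding kernel_moment_def prod_norm [symmetric]
  proof (intro prod_mono conjI norm_ge_zero)
    fix B assume B: "B \<in> subordinate_kernel G m i"
    then obtain k where "k \<in> B" using subordinate_kernelD(2) by blast
    thus "norm (c (the_elem (i ` B)) (card B)) \<le> K"
      using subordinate_kernelD [OF B] assms(2) [of k "card B"] by auto
  qed
  \<comment> \<open>There are at most \<open>m\<close> blocks, and \<open>1 \<le> K\<close> allows
    the exponent to be raised to \<open>m\<close>.\<close>
  also have "\<dots> \<le> K ^ m"
    using assms(1) card_subordinate_kernel_le by (auto intro: power_increasing)
  finally show ?thesis .
qed

text \<open>No index may be alone in its subordinate class, so every kernel block has at least two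
  elements. Since the kernel is not a pairing, some block has more; summing block sizes makes the
  inequality strict.\<close>

lemma kernel_moment_nonzero_image_small:
  fixes c :: "'i \<Rightarrow> nat \<Rightarrow> 'c::comm_semiring_1"
  assumes c1: "\<And>k. k \<in> {1..m} \<Longrightarrow> c (i k) 1 = 0"
    and "kernel_moment c G m i \<noteq> 0" "index_kernel m i \<notin> pairings m"
  shows "2 * card (i ` {1..m}) < m"
proof -
  let ?P = "index_kernel m i"
  have fin: "finite ?P" by (simp add: index_kernel_eq_fibres)
  have two: "2 \<le> card B" if B: "B \<in> ?P" for B
  proof -
    obtain k where k: "k \<in> {1..m}" "B = {l \<in> {1..m}. i l = i k}"
      using B by (auto simp: index_kernel_eq_fibres)
    then obtain k' where k': "(k, k') \<in> subordinate_rel G m i" "k' \<noteq> k"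
      using kernel_moment_eq_0 [of k m c i G] c1 assms(2) by blast
    \<comment> \<open>The subordinate relation is contained in equality of values, so the partner
      \<open>k'\<close> lies in the same kernel block.\<close>
    hence "{k, k'} \<subseteq> B" using k by (auto simp: subordinate_rel_def)
    thus ?thesis using card_mono [of B "{k, k'}"] k k'(2) by simp
  qed
  obtain B where B: "B \<in> ?P" "card B \<noteq> 2"
    using assms(3) partition_on_index_kernel by (auto simp: pairings_def)
  have "(\<Sum>B\<in>?P. 2) < (\<Sum>B\<in>?P. card B)"
    using two B fin by (intro sum_strict_mono_ex1) (auto simp: order.order_iff_strict)
  thus ?thesis by (simp add: sum_card_index_kernel card_index_kernel)
qed

section \<open>The subgraph condition\<close>

text \<open>By \<open>nested_or_crossing_iff\<close>, an arc only asks for an element of one block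
  strictly between two elements of the other. This is the configuration tested by
  \<open>subordinate_rel\<close>.\<close>

lemma labelled_nc_graph_index_kernel:
  fixes m :: nat and i :: "nat \<Rightarrow> 'i"
  defines "H \<equiv> labelled_nc_graph (index_kernel m i) i"
  shows "pverts H = i ` {1..m}"
    and "parcs H = {(i l, i k) | k k' l. {k, k', l} \<subseteq> {1..m} \<and> i k = i k' \<and> i l \<noteq> i k \<and> k < l \<and> l < k'}"
proof -
  let ?F = "\<lambda>v. {k \<in> {1..m}. i k = v}"
  \<comment> \<open>Labelling inverts the map from values to fibres, so distinct blocks keep
    distinct labels and arcs can be read off on values.\<close>
  have lab: "the_elem (i ` ?F v) = v" if "v \<in> i ` {1..m}" for v
  proof -
    have "i ` ?F v = {v}" using that by auto
    thus ?thesis by simp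
  qed
  show "pverts H = i ` {1..m}"
    unfolding H_def labelled_nc_graph_def nc_graph_def Let_def index_kernel_eq_fibres
    using lab by (simp add: image_image)
  have adj: "(?F u, ?F v) \<in> parcs (nc_graph (index_kernel m i)) \<longleftrightarrow>
      u \<noteq> v \<and> (\<exists>k\<in>?F v. \<exists>k'\<in>?F v. \<exists>l\<in>?F u. k < l \<and> l < k')"
    if "u \<in> i ` {1..m}" "v \<in> i ` {1..m}" for u v
  proof (cases "u = v")
    case False
    have "?F u \<noteq> {}" using that by auto
    moreover have "?F u \<inter> ?F v = {}" using False by auto
    moreover have "?F u \<noteq> ?F v" using calculation by auto
    moreover have "?F u \<in> index_kernel m i" "?F v \<in> index_kernel m i"
      using that unfolding index_kernel_eq_fibres by blast+
    ultimately show ?thesis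
      using nested_or_crossing_iff [of "?F v" "?F u"] False by (simp add: nc_graph_def)
  qed (simp add: nc_graph_def)
  have "parcs H = {(u, v). u \<in> i ` {1..m} \<and> v \<in> i ` {1..m} \<and>
      (?F u, ?F v) \<in> parcs (nc_graph (index_kernel m i))}" (is "_ = ?R")
  proof (intro set_eqI iffI)
    fix e assume "e \<in> parcs H"
    then obtain B C where BC: "(B, C) \<in> parcs (nc_graph (index_kernel m i))"
      "e = (the_elem (i ` B), the_elem (i ` C))"
      by (auto simp: H_def labelled_nc_graph_def Let_def)
    then obtain u v where "u \<in> i ` {1..m}" "v \<in> i ` {1..m}" "B = ?F u" "C = ?F v"
      by (auto simp: nc_graph_def index_kernel_eq_fibres)
    thus "e \<in> ?R" using BC lab by simp
  next
    fix e assume "e \<in> ?R"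
    then obtain u v where uv: "e = (u, v)" "u \<in> i ` {1..m}" "v \<in> i ` {1..m}"
      "(?F u, ?F v) \<in> parcs (nc_graph (index_kernel m i))" by auto
    hence "e = map_prod (\<lambda>W. the_elem (i ` W)) (\<lambda>W. the_elem (i ` W)) (?F u, ?F v)"
      using lab by simp
    thus "e \<in> parcs H"
      unfolding H_def labelled_nc_graph_def Let_def using uv(4) by (simp add: rev_image_eqI)
  qed
  also have "\<dots> = {(u, v). u \<in> i ` {1..m} \<and> v \<in> i ` {1..m} \<and>
      u \<noteq> v \<and> (\<exists>k\<in>?F v. \<exists>k'\<in>?F v. \<exists>l\<in>?F u. k < l \<and> l < k')}"
    (is "_ = ?R'")
  proof (rule set_eqI)
    fix e :: "'i \<times> 'i"
    obtain u v where e: "e = (u, v)" by (cases e)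
    \<comment> \<open>\<open>adj\<close> holds only for \<open>u\<close> and \<open>v\<close> in the
      image of \<open>i\<close>; \<open>conj_cong\<close> supplies these conditions from the
      preceding conjuncts.\<close>
    show "e \<in> ?R \<longleftrightarrow> e \<in> ?R'"
      by (simp only: e mem_Collect_eq prod.case adj cong: conj_cong)
  qed
  also have "\<dots> = {(i l, i k) | k k' l. {k, k', l} \<subseteq> {1..m} \<and> i k = i k' \<and> i l \<noteq> i k \<and> k < l \<and> l < k'}"
    (is "_ = ?R''")
  proof (rule set_eqI, rule iffI)
    fix e assume "e \<in> ?R'"
    then obtain u v k k' l where "e = (u, v)" "u \<noteq> v"
      "k \<in> ?F v" "k' \<in> ?F v" "l \<in> ?F u" "k < l" "l < k'"
      by blast
    hence "e = (i l, i k)" "{k, k', l} \<subseteq> {1..m}" "i k = i k'" "i l \<noteq> i k" "k < l" "l < k'"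
      by auto
    thus "e \<in> ?R''" by blast
  next
    fix e assume "e \<in> ?R''"
    then obtain k k' l where "e = (i l, i k)" "{k, k', l} \<subseteq> {1..m}" "i k = i k'" "i l \<noteq> i k" "k < l" "l < k'"
      by blast
    moreover from this have "k \<in> ?F (i k)" "k' \<in> ?F (i k)" "l \<in> ?F (i l)" by auto
    ultimately show "e \<in> ?R'" by blast
  qed
  finally show "parcs H = \<dots>" .
qed

text \<open>The arcs of the labelled graph are precisely those that \<open>subordinate_rel\<close>
  demands of \<open>G\<close> for indices with equal values. Hence the subgraph condition says that
  the two kernel relations coincide.\<close>

lemma subgraph_labelled_nc_graph_iff:
  "subgraph (with_proj (labelled_nc_graph (index_kernel m i) i))
      (induce_subgraph (with_proj G) (i ` {1..m})) \<longleftrightarrow>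
   (\<forall>k\<in>{1..m}. \<forall>k'\<in>{1..m}. i k = i k' \<longrightarrow> (k, k') \<in> subordinate_rel G m i)"
  (is "subgraph (with_proj ?H) ?G' \<longleftrightarrow> ?R")
proof -
  have "subgraph (with_proj ?H) ?G' \<longleftrightarrow> parcs ?H \<subseteq> parcs G"
    unfolding subgraph_def wf_digraph_def compatible_def
    by (auto simp: labelled_nc_graph_index_kernel)
  also have "\<dots> \<longleftrightarrow> (\<forall>k k' l. {k, k', l} \<subseteq> {1..m} \<and> i k = i k' \<and> i l \<noteq> i k \<and> k < l \<and> l < k'
      \<longrightarrow> (i l, i k) \<in> parcs G)" (is "_ \<longleftrightarrow> ?A")
    unfolding labelled_nc_graph_index_kernel by blast
  also have "\<dots> \<longleftrightarrow> ?R"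
  proof
    assume A: ?A
    have "(i l, i k) \<in> parcs G"
      if "k \<in> {1..m}" "k' \<in> {1..m}" "i k = i k'" "min k k' < l" "l < max k k'" "i l \<noteq> i k" for k k' l
    proof (cases "k < k'")
      case True
      thus ?thesis using that A [rule_format, of k k' l] by simp
    next
      \<comment> \<open>For \<open>k' < k\<close> the roles are swapped, since \<open>?A\<close>
        treats ordered pairs only; for \<open>k = k'\<close> no \<open>l\<close> lies strictly
        between.\<close>
      case False
      thus ?thesis using that A [rule_format, of k' k l] by (simp add: min_def max_def split: if_splits)
    qed
    thus ?R by (auto simp: subordinate_rel_def)
  next
    assume R: ?R
    show ?A
    proof (intro allI impI)
      fix k k' l
      assume "{k, k', l} \<subseteq> {1..m} \<and> i k = i k' \<and> i l \<noteq> i k \<and> k < l \<and> l < k'"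
      moreover from this have "(k, k') \<in> subordinate_rel G m i" using R by simp
      ultimately show "(i l, i k) \<in> parcs G" by (auto simp: subordinate_rel_def)
    qed
  qed
  finally show ?thesis .
qed

text \<open>If the two kernels agree, every factor is a second moment, hence \<open>1\<close>.
  Otherwise some pair is split, and a singleton block annihilates the product.\<close>

lemma kernel_moment_pairing:
  fixes c :: "'i \<Rightarrow> nat \<Rightarrow> 'c::comm_semiring_1"
  assumes c1: "\<And>k. k \<in> {1..m} \<Longrightarrow> c (i k) 1 = 0"
    and c2: "\<And>k. k \<in> {1..m} \<Longrightarrow> c (i k) 2 = 1"
    and pair: "index_kernel m i \<in> pairings m"
  shows "kernel_moment c G m i =
    of_bool (subgraph (with_proj (labelled_nc_graph (index_kernel m i) i))
               (induce_subgraph (with_proj G) (i ` {1..m})))"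
proof (cases "\<forall>k\<in>{1..m}. \<forall>k'\<in>{1..m}. i k = i k' \<longrightarrow> (k, k') \<in> subordinate_rel G m i")
  case True
  hence "subordinate_rel G m i = {(k, k'). k \<in> {1..m} \<and> k' \<in> {1..m} \<and> i k = i k'}"
    by (auto simp: subordinate_rel_def)
  hence eq: "subordinate_kernel G m i = index_kernel m i"
    by (simp add: subordinate_kernel_def index_kernel_def)
  have "c (the_elem (i ` B)) (card B) = 1" if B: "B \<in> subordinate_kernel G m i" for B
  proof -
    obtain k where "k \<in> B" using subordinate_kernelD(2) [OF B] by blast
    moreover have "card B = 2" using B pair unfolding eq by (simp add: pairings_def)
    ultimately show ?thesis using subordinate_kernelD(3,4) [OF B] c2 by auto
  qed
  hence "kernel_moment c G m i = 1" by (simp add: kernel_moment_def)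
  thus ?thesis unfolding subgraph_labelled_nc_graph_iff using True by simp
next
  case False
  then obtain k k' where k: "k \<in> {1..m}" "k' \<in> {1..m}" "i k = i k'" "(k, k') \<notin> subordinate_rel G m i"
    by blast
  let ?B = "{l \<in> {1..m}. i l = i k}"
  have "k \<noteq> k'" using k by (auto simp: subordinate_rel_def)
  moreover have "?B \<in> index_kernel m i" unfolding index_kernel_eq_fibres using k(1) by blast
  hence "card ?B = 2" using pair by (simp add: pairings_def)
  \<comment> \<open>The block is exhausted by \<open>k\<close> and \<open>k'\<close>, which are
    unrelated, so \<open>k\<close> is related only to itself.\<close>
  ultimately have "?B = {k, k'}"
    using k by (intro card_subset_eq [symmetric]) auto
  hence "l = k" if "(k, l) \<in> subordinate_rel G m i" for l
    using that k(4) by (auto simp: subordinate_rel_def)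
  hence "kernel_moment c G m i = 0" using k(1) c1 by (intro kernel_moment_eq_0) auto
  thus ?thesis unfolding subgraph_labelled_nc_graph_iff using False by simp
qed

section \<open>Counting tuples with few values\<close>

text \<open>A function with at most \<open>r\<close> values factors through \<open>{..<r}\<close>:
  first a label for each argument, then a value for each label. Counting such pairs overcounts,
  which is harmless for an upper bound.\<close>

lemma card_functions_small_image:
  assumes "finite A" "finite S" "S \<noteq> {}"
  shows "card {f \<in> S \<rightarrow>\<^sub>E A. card (f ` S) \<le> r} \<le> r ^ card S * card A ^ r"
proof (cases "A = {}")
  case False
  \<comment> \<open>Filler value for the labels in \<open>{..<r}\<close> that are left over when
    \<open>f\<close> has fewer than \<open>r\<close> values.\<close>
  then obtain a0 where a0: "a0 \<in> A" by blast
  let ?D = "(S \<rightarrow>\<^sub>E {..<r}) \<times> ({..<r} \<rightarrow>\<^sub>E A)"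
  have "{f \<in> S \<rightarrow>\<^sub>E A. card (f ` S) \<le> r} \<subseteq> (\<lambda>(g, h). restrict (h \<circ> g) S) ` ?D"
  proof
    fix f assume f: "f \<in> {f \<in> S \<rightarrow>\<^sub>E A. card (f ` S) \<le> r}"
    obtain e where e: "bij_betw e (f ` S) {..<card (f ` S)}"
      using ex_bij_betw_finite_nat [of "f ` S"] assms(2) by (auto simp: atLeast0LessThan)
    let ?g = "restrict (e \<circ> f) S"
    let ?h = "restrict (\<lambda>n. if n < card (f ` S) then inv_into (f ` S) e n else a0) {..<r}"
    have lt: "e (f x) < card (f ` S)" if "x \<in> S" for x
      using that e by (auto simp: bij_betw_def)
    have inv: "inv_into (f ` S) e (e (f x)) = f x" if "x \<in> S" for x
      using that e by (intro inv_into_f_f) (auto simp: bij_betw_def)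
    have "?g \<in> S \<rightarrow>\<^sub>E {..<r}" using f lt by fastforce
    moreover have "inv_into (f ` S) e n \<in> A" if "n < card (f ` S)" for n
    proof -
      have "inv_into (f ` S) e n \<in> f ` S"
        using that e by (intro inv_into_into) (auto simp: bij_betw_def)
      thus ?thesis using f by auto
    qed
    hence "?h \<in> {..<r} \<rightarrow>\<^sub>E A" using a0 by auto
    moreover have "f = restrict (?h \<circ> ?g) S"
    proof
      fix x
      show "f x = restrict (?h \<circ> ?g) S x"
      proof (cases "x \<in> S")
        case True
        have "e (f x) < r" using lt [OF True] f by simp
        thus ?thesis using True lt [OF True] inv [OF True] by simp
      next
        case False
        thus ?thesis using f PiE_arb [of f S "\<lambda>_. A" x] by simp
      qed
    qed
    ultimately show "f \<in> (\<lambda>(g, h). restrict (h \<circ> g) S) ` ?D"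
      by (intro image_eqI [where x = "(?g, ?h)"]) (simp_all only: prod.case mem_Sigma_iff simp_thms)
  qed
  moreover have "finite ?D" using assms by (intro finite_cartesian_product finite_PiE) auto
  ultimately have "card {f \<in> S \<rightarrow>\<^sub>E A. card (f ` S) \<le> r} \<le> card ?D"
    by (rule surj_card_le [rotated])
  thus ?thesis using assms(2) by (simp add: card_cartesian_product card_funcsetE)
next
  case True
  hence "S \<rightarrow>\<^sub>E A = {}" using assms(3) by (auto simp: PiE_eq_empty_iff)
  thus ?thesis by simp
qed

section \<open>Moments of normalised sums\<close>

text \<open>All factors in a block carry the same label, so each block product is a power of one
  variable.\<close>

lemma BMT_moment:
  assumes "BMT_independent scale \<phi> G (\<lambda>j. generated_subalgebra scale (a j))"
    and "m \<ge> 1" "\<And>k. k \<in> {1..m} \<Longrightarrow> i k \<in> pverts G"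
  shows "\<phi> (block_prod (a \<circ> i) {1..m}) = kernel_moment (\<lambda>j n. \<phi> (a j ^ n)) G m i"
proof -
  have "a j \<in> generated_subalgebra scale (a j)" for j
    unfolding generated_subalgebra_def by (rule hull_inc) simp
  hence "\<phi> (block_prod (a \<circ> i) {1..m}) =
      (\<Prod>B\<in>subordinate_kernel G m i. \<phi> (block_prod (a \<circ> i) B))"
    using assms unfolding BMT_independent_def by simp
  also have "\<dots> = kernel_moment (\<lambda>j n. \<phi> (a j ^ n)) G m i"
    unfolding kernel_moment_def
  proof (rule prod.cong [OF refl])
    fix B assume B: "B \<in> subordinate_kernel G m i"
    show "\<phi> (block_prod (a \<circ> i) B) = \<phi> (a (the_elem (i ` B)) ^ card B)"
      using subordinate_kernelD(1,4) [OF B]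
      by (intro arg_cong [where f = \<phi>] block_prod_const) auto
  qed
  finally show ?thesis .
qed

lemma (in nc_probability_space) scale_power: "scale c x ^ n = scale (c ^ n) (x ^ n)"
  by (induction n) (simp_all add: scale_mult_left scale_mult_right)

lemma (in nc_probability_space) state_power_sum_expand:
  assumes "finite A"
  shows "\<phi> (scale c (\<Sum>j\<in>A. a j) ^ m) = c ^ m * (\<Sum>i\<in>{1..m} \<rightarrow>\<^sub>E A. \<phi> (block_prod (a \<circ> i) {1..m}))"
  unfolding scale_power sum_power_expand [OF assms] by (simp add: scale sum)

theorem theorem5p3:
  fixes scale :: "complex \<Rightarrow> 'a::ring_1 \<Rightarrow> 'a"
    and \<phi> :: "'a \<Rightarrow> complex"
    and a :: "nat \<Rightarrow> 'a"
    and G :: "nat \<Rightarrow> nat pair_pre_digraph"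
    and m :: nat
  assumes "nc_probability_space scale \<phi>"
    and "\<And>j. j \<ge> 1 \<Longrightarrow> \<phi> (a j) = 0"
    and "\<And>j. j \<ge> 1 \<Longrightarrow> \<phi> (a j ^ 2) = 1"
    and "\<And>n. n \<ge> 1 \<Longrightarrow> bdd_above ((\<lambda>j. cmod (\<phi> (a j ^ n))) ` {1..})"
    and "\<And>N. N \<ge> 1 \<Longrightarrow> pair_loopfree_digraph (G N)"
    and "\<And>N. N \<ge> 1 \<Longrightarrow> pverts (G N) = {1..N}"
    and "\<And>N. N \<ge> 2 \<Longrightarrow> subgraph (with_proj (G (N - 1))) (with_proj (G N))"
    and "\<And>N. N \<ge> 1 \<Longrightarrow> BMT_independent scale \<phi> (G N) (\<lambda>j. generated_subalgebra scale (a j))"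
    and "m \<ge> 1"
  shows "(\<lambda>N. \<phi> (scale (complex_of_real (1 / sqrt (real N))) (\<Sum>j=1..N. a j) ^ m)
            - (\<Sum>\<pi>\<in>pairings m. complex_of_real (real N powr (- real m / 2)) *
                 (\<Sum>i | i \<in> {1..m} \<rightarrow>\<^sub>E {1..N} \<and> index_kernel m i = \<pi>.
                    of_bool (subgraph (with_proj (labelled_nc_graph \<pi> i))
                                      (induce_subgraph (with_proj (G N)) (i ` {1..m}))))))
         \<in> O(\<lambda>N. complex_of_real (real N powr (- 1 / 2)))"
proof -
  interpret nc_probability_space scale \<phi> by fact
  define c where "c = (\<lambda>j n. \<phi> (a j ^ n))"
  define T where "T = (\<lambda>N :: nat. {1..m} \<rightarrow>\<^sub>E {1..N})"
  \<comment> \<open>The largest natural number strictly below \<open>m / 2\<close>, hence the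
    maximal number of values of a tuple outside the pairings with non-zero moment.\<close>
  define r where "r = (m - 1) div 2"
  \<comment> \<open>Blocks have at most \<open>m\<close> elements, so only finitely many orders
    occur and their separate bounds merge into one.\<close>
  have "bdd_above (\<Union>n\<in>{1..m}. (\<lambda>j. cmod (c j n)) ` {1..})"
    using assms(4) by (simp add: c_def)
  then obtain K0 where K0: "\<And>j n. j \<ge> 1 \<Longrightarrow> 1 \<le> n \<Longrightarrow> n \<le> m \<Longrightarrow> cmod (c j n) \<le> K0"
    unfolding bdd_above_def by fastforce
  define K where "K = max 1 K0"
  have K: "1 \<le> K" "\<And>j n. j \<ge> 1 \<Longrightarrow> 1 \<le> n \<Longrightarrow> n \<le> m \<Longrightarrow> cmod (c j n) \<le> K"
    using K0 by (auto simp: K_def intro: max.coboundedI2)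
  let ?E = "\<lambda>N i. subgraph (with_proj (labelled_nc_graph (index_kernel m i) i))
                    (induce_subgraph (with_proj (G N)) (i ` {1..m}))"
  let ?E' = "\<lambda>N \<pi> i. subgraph (with_proj (labelled_nc_graph \<pi> i))
                    (induce_subgraph (with_proj (G N)) (i ` {1..m}))"
  let ?Q = "\<lambda>N. {i \<in> T N. index_kernel m i \<in> pairings m}"
  let ?R = "\<lambda>N. {i \<in> T N. index_kernel m i \<notin> pairings m}"
  have finT: "finite (T N)" for N unfolding T_def by (intro finite_PiE) auto
  have finP: "finite (pairings m)"
    unfolding pairings_def by (rule finite_subset [OF _ finitely_many_partition_on [of "{1..m}"]]) auto
  \<comment> \<open>An exact identity: the pairing tuples reproduce the main term, and the error is
    the contribution of all other tuples.\<close>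
  have diff: "\<phi> (scale (complex_of_real (1 / sqrt (real N))) (\<Sum>j=1..N. a j) ^ m)
            - (\<Sum>\<pi>\<in>pairings m. complex_of_real (real N powr (- real m / 2)) *
                 (\<Sum>i | i \<in> {1..m} \<rightarrow>\<^sub>E {1..N} \<and> index_kernel m i = \<pi>. of_bool (?E' N \<pi> i)))
        = complex_of_real (real N powr (- real m / 2)) * (\<Sum>i\<in>?R N. kernel_moment c (G N) m i)"
    (is "?L - ?S = ?w * _") if N: "N \<ge> 1" for N
  proof -
    have "(1 / sqrt (real N)) ^ m = real N powr (- real m / 2)"
      using N by (simp add: powr_half_sqrt [symmetric] powr_minus_divide [symmetric] powr_realpow [symmetric] powr_powr)
    hence w: "complex_of_real (1 / sqrt (real N)) ^ m = ?w"
      by (metis of_real_power)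
    have "?L = ?w * (\<Sum>i\<in>T N. \<phi> (block_prod (a \<circ> i) {1..m}))"
      unfolding state_power_sum_expand [OF finite_atLeastAtMost] w T_def ..
    also have "(\<Sum>i\<in>T N. \<phi> (block_prod (a \<circ> i) {1..m})) = (\<Sum>i\<in>T N. kernel_moment c (G N) m i)"
      unfolding c_def using assms(6,8,9) N
      by (intro sum.cong refl BMT_moment [where scale = scale]) (auto simp: T_def PiE_iff)
    also have "\<dots> = (\<Sum>i\<in>?Q N \<union> ?R N. kernel_moment c (G N) m i)"
      by (intro sum.cong) auto
    also have "\<dots> = (\<Sum>i\<in>?Q N. kernel_moment c (G N) m i) + (\<Sum>i\<in>?R N. kernel_moment c (G N) m i)"
      using finT [of N] by (intro sum.union_disjoint) auto
    also have "(\<Sum>i\<in>?Q N. kernel_moment c (G N) m i) = (\<Sum>i\<in>?Q N. of_bool (?E N i))"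
      using assms(2,3) by (intro sum.cong refl kernel_moment_pairing) (auto simp: c_def T_def PiE_iff)
    \<comment> \<open>Tuples are grouped by their kernel, which becomes the outer summation
      index.\<close>
    also have "\<dots> = (\<Sum>\<pi>\<in>pairings m. \<Sum>i | i \<in> ?Q N \<and> index_kernel m i = \<pi>. of_bool (?E N i))"
      using finT [of N] finP by (intro sum.group [symmetric]) auto
    also have "\<dots> = (\<Sum>\<pi>\<in>pairings m. \<Sum>i | i \<in> {1..m} \<rightarrow>\<^sub>E {1..N} \<and> index_kernel m i = \<pi>. of_bool (?E' N \<pi> i))"
      by (intro sum.cong) (auto simp: T_def)
    finally show ?thesis by (simp add: sum_distrib_left distrib_left)
  qed
  have bound: "cmod (complex_of_real (real N powr (- real m / 2)) * (\<Sum>i\<in>?R N. kernel_moment c (G N) m i))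
      \<le> (real r ^ m * K ^ m) * cmod (complex_of_real (real N powr (- 1 / 2)))" if N: "N \<ge> 1" for N
  proof -
    let ?few = "{i \<in> T N. card (i ` {1..m}) \<le> r}"
    \<comment> \<open>Terms outside \<open>?few\<close> vanish. Writing the bound with a conditional
      lets the sum be extended to all of \<open>T N\<close> and then counted.\<close>
    have "cmod (\<Sum>i\<in>?R N. kernel_moment c (G N) m i) \<le> (\<Sum>i\<in>?R N. if i \<in> ?few then K ^ m else 0)"
    proof (rule sum_norm_le)
      fix i assume i: "i \<in> ?R N"
      hence pos: "i k \<ge> 1" if "k \<in> {1..m}" for k using that by (auto simp: T_def PiE_iff)
      show "cmod (kernel_moment c (G N) m i) \<le> (if i \<in> ?few then K ^ m else 0)"
      proof (cases "kernel_moment c (G N) m i = 0")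
        case False
        hence "2 * card (i ` {1..m}) < m"
          using i pos assms(2) by (intro kernel_moment_nonzero_image_small [of m c i "G N"]) (auto simp: c_def)
        hence "i \<in> ?few" using i by (auto simp: r_def)
        moreover have "cmod (kernel_moment c (G N) m i) \<le> K ^ m"
          using pos K by (intro norm_kernel_moment_le) auto
        ultimately show ?thesis by simp
      qed (use K(1) in simp)
    qed
    also have "\<dots> \<le> (\<Sum>i\<in>T N. if i \<in> ?few then K ^ m else 0)"
      using K(1) by (intro sum_mono2 finT) auto
    also have "\<dots> = real (card ?few) * K ^ m"
      using finT [of N] by (simp add: sum.If_cases Int_def)
    also have "\<dots> \<le> real (r ^ m * N ^ r) * K ^ m"
      using card_functions_small_image [of "{1..N}" "{1..m}" r] K(1)
      assms(9)
      by (intro mult_right_mono of_nat_mono) (auto simp: T_def)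
    finally have "cmod (\<Sum>i\<in>?R N. kernel_moment c (G N) m i) \<le> real r ^ m * K ^ m * real N ^ r"
      by (simp add: mult_ac)
    hence "cmod (complex_of_real (real N powr (- real m / 2)) * (\<Sum>i\<in>?R N. kernel_moment c (G N) m i))
        \<le> real N powr (- real m / 2) * (real r ^ m * K ^ m * real N ^ r)"
      by (simp add: norm_mult mult_left_mono)
    also have "\<dots> = real r ^ m * K ^ m * real N powr (real r - real m / 2)"
      using N by (simp add: powr_realpow [symmetric] powr_add [symmetric] mult_ac)
    \<comment> \<open>The gain of half a power comes from integrality: \<open>2 * r < m\<close>
      already forces \<open>2 * r + 1 \<le> m\<close>.\<close>
    also have "real N powr (real r - real m / 2) \<le> real N powr (- 1 / 2)"
    proof (rule powr_mono)
      have "2 * r + 1 \<le> m" using assms(9) by (simp add: r_def)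
      thus "real r - real m / 2 \<le> - 1 / 2" by linarith
    qed (use N in simp)
    finally show ?thesis using K(1) by (simp add: mult_left_mono)
  qed
  show ?thesis
    \<comment> \<open>The estimates start at \<open>N = 1\<close>, since nothing is assumed about
      \<open>G 0\<close>.\<close>
    by (rule bigoI [where c = "real r ^ m * K ^ m"], rule eventually_sequentiallyI [of 1])
       (use diff bound in simp)
qed

end
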